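(* For $A=(a_{ij})_{i,j=1}^2\in M_2(\mathbb C)$, the following are equivalent: (1) $\mu_{\mathrm{hexa}}(A)<1$; (2) $1-a_{11}z_1-a_{22}z_2+\det(A)z_1z_2\neq a_{21}w$ for all $z_1,z_2,w\in\overline{\mathbb D}$ with $|w|\le\sqrt{(1-|z_1|^2)(1-|z_2|^2)}$; (3) $(a_{11},a_{22},\det(A))\in\mathbb E$ and $\sup_{z_1,z_2\in\mathbb D}|\psi_{z_1,z_2}(a_{21},a_{11},a_{22},\det(A))|<1$; (4) $(a_{11},a_{22},\det(A))\in\mathbb E$ and $|\psi_{z_1,z_2}(a_{21},a_{11},a_{22},\det(A))|<1$ for every $z_1,z_2\in\mathbb D$; (5) $(a_{11},a_{22},\det(A))\in\mathbb E$ and $|a_{21}|\,K_*(a_{11},a_{22},\det(A))<1$. Therefore, $$\mathbb H_\mu=\{(a_{21},a_{11},a_{22},\det(A))\in\mathbb C\times\mathbb E : A=(a_{ij})_{i,j=1}^2\in M_2(\mathbb C),\ |a_{21}|K_*(a_{11},a_{22},\det(A))<1\}.$$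
   Context: $\mathbb D$ is the open unit disc in $\mathbb C$, $\overline{\mathbb D}$ its closure; $\|\cdot\|$ is the operator norm on $M_2(\mathbb C)$ induced by the Euclidean norm on $\mathbb C^2$. Let $E\subset M_2(\mathbb C)$ be the linear space of all upper triangular matrices. For $A\in M_2(\mathbb C)$, $$\mu_{\mathrm{hexa}}(A)=\frac{1}{\inf\{\|X\| : X\in E,\ \det(I-AX)=0\}},$$ with $\mu_{\mathrm{hexa}}(A)=0$ if $\det(I-AX)\ne0$ for all $X\in E$. $\pi:M_2(\mathbb C)\to\mathbb C^4$ is $\pi((a_{ij}))=(a_{21},a_{11},a_{22},\det(A))$, and the $\mu$-hexablock is $\mathbb H_\mu=\{\pi(A): A\in M_2(\mathbb C),\ \mu_{\mathrm{hexa}}(A)<1\}$. The tetrablock is $\mathbb E=\{(x_1,x_2,x_3)\in\mathbb C^3: 1-x_1z_1-x_2z_2+x_3z_1z_2\ne0 \text{ for all } z_1,z_2\in\overline{\mathbb D}\}$. For $(a,x_1,x_2,x_3)\in\mathbb C\times\mathbb E$ and $z_1,z_2\in\overline{\mathbb D}$, $\psi_{z_1,z_2}(a,x_1,x_2,x_3)=\dfrac{a\sqrt{(1-|z_1|^2)(1-|z_2|^2)}}{1-x_1z_1-x_2z_2+x_3z_1z_2}$. For $(x_1,x_2,x_3)\in\mathbb E$, $K_*(x_1,x_2,x_3)=\max_{z_1,z_2\in\overline{\mathbb D}}\left|\dfrac{\sqrt{(1-|z_1|^2)(1-|z_2|^2)}}{1-x_1z_1-x_2z_2+x_3z_1z_2}\right|$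 (a maximum of a continuous function on a compact set). *)

theory Defs
  imports "HOL-Analysis.Analysis"
begin

text \<open>
  Matrices in \<open>M_2(\<complex>)\<close> have type \<^typ>\<open>complex^2^2\<close>; since the norm on \<^typ>\<open>complex^2\<close> is the
  Euclidean one, \<^const>\<open>onorm\<close> of \<open>(*v) X\<close> is the operator norm of \<open>X\<close>.
\<close>

definition upper_triangular :: "(complex^2^2) set" where
  "upper_triangular = {X. X $ 2 $ 1 = 0}"

definition mu_hexa :: "complex^2^2 \<Rightarrow> real" where
  "mu_hexa A =
     (if \<forall>X\<in>upper_triangular. det (mat 1 - A ** X) \<noteq> 0 then 0
      else 1 / Inf {onorm ((*v) X) | X. X \<in> upper_triangular \<and> det (mat 1 - A ** X) = 0})"

definition hexa_proj :: "complex^2^2 \<Rightarrow> complex \<times> complex \<times> complex \<times> complex" where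
  "hexa_proj A = (A $ 2 $ 1, A $ 1 $ 1, A $ 2 $ 2, det A)"

definition mu_hexablock :: "(complex \<times> complex \<times> complex \<times> complex) set" where
  "mu_hexablock = {hexa_proj A | A. mu_hexa A < 1}"

definition tetrablock :: "(complex \<times> complex \<times> complex) set" where
  "tetrablock = {(x1, x2, x3).
     \<forall>z1\<in>cball 0 1. \<forall>z2\<in>cball 0 1. 1 - x1 * z1 - x2 * z2 + x3 * z1 * z2 \<noteq> 0}"

fun psi :: "complex \<Rightarrow> complex \<Rightarrow> complex \<times> complex \<times> complex \<times> complex \<Rightarrow> complex" where
  "psi z1 z2 (a, x1, x2, x3) =
     a * complex_of_real (sqrt ((1 - (cmod z1)\<^sup>2) * (1 - (cmod z2)\<^sup>2))) /
     (1 - x1 * z1 - x2 * z2 + x3 * z1 * z2)"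

text \<open>
  The maximum is rendered as a supremum, as \<^const>\<open>Max\<close> is meant for finite sets;
  \<open>K_star_attained\<close> below shows that on the tetrablock it is indeed a maximum.
\<close>

fun K_star :: "complex \<times> complex \<times> complex \<Rightarrow> real" where
  "K_star (x1, x2, x3) =
     (SUP (z1, z2) \<in> cball 0 1 \<times> cball 0 1.
        cmod (complex_of_real (sqrt ((1 - (cmod z1)\<^sup>2) * (1 - (cmod z2)\<^sup>2))) /
              (1 - x1 * z1 - x2 * z2 + x3 * z1 * z2)))"

lemma continuous_on_psi:
  assumes "(x1, x2, x3) \<in> tetrablock"
  shows "continuous_on (cball 0 1 \<times> cball 0 1) (\<lambda>(z1, z2). cmod (psi z1 z2 (a, x1, x2, x3)))"
  using assms unfolding split_beta psi.simps tetrablock_def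
  by (intro continuous_intros) auto

lemma psi_attains_max:
  assumes "(x1, x2, x3) \<in> tetrablock"
  shows "\<exists>z1\<in>cball 0 1. \<exists>z2\<in>cball 0 1. \<forall>w1\<in>cball 0 1. \<forall>w2\<in>cball 0 1.
           cmod (psi w1 w2 (a, x1, x2, x3)) \<le> cmod (psi z1 z2 (a, x1, x2, x3))"
proof -
  have "compact (cball (0::complex) 1 \<times> cball (0::complex) 1)"
    by (intro compact_Times compact_cball)
  moreover have "cball (0::complex) 1 \<times> cball (0::complex) 1 \<noteq> {}" by auto
  ultimately show ?thesis
    using continuous_attains_sup[OF _ _ continuous_on_psi[OF assms, of a]] by auto
qed

text \<open>In particular the real supremum of \<open>\<bar>\<psi>\<bar>\<close> over the open bidisc is that of a bounded set.\<close>

lemma bdd_above_psi: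
  assumes "(x1, x2, x3) \<in> tetrablock"
  shows "bdd_above ((\<lambda>(z1, z2). cmod (psi z1 z2 (a, x1, x2, x3))) ` (ball 0 1 \<times> ball 0 1))"
proof -
  obtain z1 z2 where "\<forall>w1\<in>cball 0 1. \<forall>w2\<in>cball 0 1.
      cmod (psi w1 w2 (a, x1, x2, x3)) \<le> cmod (psi z1 z2 (a, x1, x2, x3))"
    using psi_attains_max[OF assms] by blast
  then show ?thesis
    by (intro bdd_aboveI[where M = "cmod (psi z1 z2 (a, x1, x2, x3))"])
       (auto simp del: psi.simps)
qed

lemma K_star_attained:
  assumes "(x1, x2, x3) \<in> tetrablock"
  shows "\<exists>z1\<in>cball 0 1. \<exists>z2\<in>cball 0 1. K_star (x1, x2, x3) = cmod (psi z1 z2 (1, x1, x2, x3)) \<and>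
           (\<forall>w1\<in>cball 0 1. \<forall>w2\<in>cball 0 1. cmod (psi w1 w2 (1, x1, x2, x3)) \<le> K_star (x1, x2, x3))"
proof -
  obtain z1 z2 where z: "z1 \<in> cball 0 1" "z2 \<in> cball 0 1"
    and m: "\<forall>w1\<in>cball 0 1. \<forall>w2\<in>cball 0 1.
      cmod (psi w1 w2 (1, x1, x2, x3)) \<le> cmod (psi z1 z2 (1, x1, x2, x3))"
    using psi_attains_max[OF assms] by blast
  have "K_star (x1, x2, x3) =
      Sup ((\<lambda>(z1, z2). cmod (psi z1 z2 (1, x1, x2, x3))) ` (cball 0 1 \<times> cball 0 1))"
    by simp
  also have "\<dots> = cmod (psi z1 z2 (1, x1, x2, x3))"
    by (rule cSup_eq_maximum) (use z m in \<open>auto simp del: psi.simps\<close>)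
  finally show ?thesis using z m by metis
qed

end

theory Submission
  imports Defs
begin

text \<open>
  For an upper triangular \<open>X\<close> with diagonal \<open>z1\<close>, \<open>z2\<close> and corner \<open>w\<close>, the
  determinant of \<open>I - A X\<close> equals
  \<open>1 - a11 z1 - a22 z2 + det A z1 z2 - a21 w\<close>: the entry \<open>a12\<close> enters only
  through \<open>det A\<close>.  Moreover \<open>X\<close> is a contraction exactly when \<open>z1\<close>, \<open>z2\<close> lie in the
  closed disc and \<open>|w|\<^sup>2 \<le> (1 - |z1|\<^sup>2) (1 - |z2|\<^sup>2)\<close>, which says that \<open>I - X* X\<close> has
  nonnegative determinant and diagonal (\<open>upper_triangular_contraction_iff\<close>).  Since the
  infimum in the definition of \<^const>\<open>mu_hexa\<close> is attained at a nonzero matrix whenever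
  its index set is nonempty, \<open>mu_hexa A < 1\<close> says precisely that \<open>I - A X\<close> is nonsingular
  for every upper triangular contraction \<open>X\<close> (\<open>mu_hexa_less_one_iff\<close>).  Together these
  facts give the description by nonvanishing, \<open>mu_hexa_less_one_iff_no_zero\<close>.

  Now fix \<open>z1\<close>, \<open>z2\<close> and let \<open>w\<close> vary over its disc of radius
  \<open>s = sqrt ((1 - |z1|\<^sup>2) (1 - |z2|\<^sup>2))\<close>.  The value \<open>w = 0\<close> gives membership in the
  tetrablock, so the denominator \<open>D\<close> of \<^const>\<open>psi\<close> does not vanish; and \<open>a21 w\<close> omits
  \<open>D\<close> for all \<open>|w| \<le> s\<close> exactly when \<open>|a21| s < |D|\<close>, that is, when \<open>|\<psi>| < 1\<close>
  (\<open>psi_less_one_iff\<close>).  This yields the condition \<open>|\<psi>| < 1\<close> on the \<^emph>\<open>closed\<close> bidisc.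
  The remaining conditions are reformulations: \<open>\<psi>\<close> vanishes as soon as \<open>|z1| = 1\<close> or
  \<open>|z2| = 1\<close>, so the open bidisc suffices; and \<open>|\<psi>|\<close> attains its maximum
  \<open>|a21| K_*\<close> on the closed bidisc, so that the pointwise bound is a uniform one.
\<close>

section \<open>Upper triangular contractions\<close>

lemma det_one_minus_upper_triangular:
  fixes A X :: "complex^2^2"
  assumes "X \<in> upper_triangular"
  shows "det (mat 1 - A ** X) =
    1 - A $ 1 $ 1 * X $ 1 $ 1 - A $ 2 $ 2 * X $ 2 $ 2 + det A * X $ 1 $ 1 * X $ 2 $ 2
      - A $ 2 $ 1 * X $ 1 $ 2"
  using assms
  by (simp add: upper_triangular_def det_2 matrix_matrix_mult_def sum_2 mat_def algebra_simps)

lemma norm_vec2_power2: "(norm (v :: complex^2))\<^sup>2 = (cmod (v $ 1))\<^sup>2 + (cmod (v $ 2))\<^sup>2"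
  by (simp add: norm_vec_def L2_set_def sum_2)

lemma onorm_le_one_iff:
  fixes X :: "complex^2^2"
  shows "onorm ((*v) X) \<le> 1 \<longleftrightarrow> (\<forall>v. norm (X *v v) \<le> norm v)"
proof
  assume "onorm ((*v) X) \<le> 1"
  then show "\<forall>v. norm (X *v v) \<le> norm v"
    by (metis matrix_vector_mul_bounded_linear onorm mult_right_mono norm_ge_zero mult_1 order_trans)
qed (auto intro: onorm_le)

text \<open>
  Write \<open>p\<close>, \<open>q\<close>, \<open>m\<close> for the squared moduli of \<open>z1\<close>, \<open>z2\<close>, \<open>w\<close>.  If
  \<open>m \<le> (1 - p) (1 - q)\<close>, the Cauchy-Schwarz inequality for the vectors
  \<open>(|z1|, sqrt (1 - p))\<close> and \<open>(|v1|, sqrt (1 - q) |v2|)\<close> bounds the first component of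
  \<open>X v\<close>, and the second one contributes exactly the missing \<open>q |v2|\<^sup>2\<close>.  Conversely,
  applying \<open>X\<close> to suitable test vectors forces the three inequalities.
\<close>

lemma upper_triangular_contraction_iff:
  assumes "X \<in> upper_triangular"
  shows "onorm ((*v) X) \<le> 1 \<longleftrightarrow>
    cmod (X $ 1 $ 1) \<le> 1 \<and> cmod (X $ 2 $ 2) \<le> 1 \<and>
    cmod (X $ 1 $ 2) \<le> sqrt ((1 - (cmod (X $ 1 $ 1))\<^sup>2) * (1 - (cmod (X $ 2 $ 2))\<^sup>2))"
proof -
  define z1 z2 w where "z1 = X $ 1 $ 1" and "z2 = X $ 2 $ 2" and "w = X $ 1 $ 2"
  define p q m where "p = (cmod z1)\<^sup>2" and "q = (cmod z2)\<^sup>2" and "m = (cmod w)\<^sup>2"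
  have nonneg: "p \<ge> 0" "q \<ge> 0" "m \<ge> 0"
    by (simp_all add: p_def q_def m_def)
  have comps: "(X *v v) $ 1 = z1 * v $ 1 + w * v $ 2" "(X *v v) $ 2 = z2 * v $ 2" for v :: "complex^2"
    using assms
    by (simp_all add: upper_triangular_def matrix_vector_mult_def sum_2 z1_def z2_def w_def)
  have contr: "norm (X *v v) \<le> norm v \<longleftrightarrow>
      (cmod (z1 * v $ 1 + w * v $ 2))\<^sup>2 + (cmod (z2 * v $ 2))\<^sup>2 \<le>
      (cmod (v $ 1))\<^sup>2 + (cmod (v $ 2))\<^sup>2" for v :: "complex^2"
    unfolding norm_vec2_power2[symmetric] comps[symmetric] by simp
  have sq_conv: "cmod z1 \<le> 1 \<longleftrightarrow> p \<le> 1" "cmod z2 \<le> 1 \<longleftrightarrow> q \<le> 1"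
    by (simp_all add: p_def q_def abs_square_le_1)
  have w_conv: "cmod w \<le> sqrt ((1 - p) * (1 - q)) \<longleftrightarrow> m \<le> (1 - p) * (1 - q)"
    by (metis m_def norm_ge_zero real_le_rsqrt real_sqrt_le_iff real_sqrt_unique)
  have "(\<forall>v. norm (X *v v) \<le> norm v) \<longleftrightarrow> p \<le> 1 \<and> q \<le> 1 \<and> m \<le> (1 - p) * (1 - q)"
  proof (intro iffI conjI allI)
    assume R: "\<forall>v. norm (X *v v) \<le> norm v"
    have test: "(cmod (z1 * a + w * b))\<^sup>2 + (cmod (z2 * b))\<^sup>2 \<le> (cmod a)\<^sup>2 + (cmod b)\<^sup>2" for a b
      using R contr[of "vector [a, b]"] by simp
    show "p \<le> 1" using test[of 1 0] by (simp add: p_def)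
    show "q \<le> 1" using test[of 0 1] unfolding q_def by (simp add: add_increasing) (smt (verit) zero_le_power2)
    show "m \<le> (1 - p) * (1 - q)"
    proof (cases "p = 1")
      case True
      \<comment> \<open>The conjugated first row as test vector shows that this row has norm at most one,
        so a unimodular \<open>z1\<close> leaves no room for \<open>w\<close>.\<close>
      have "cmod (z1 * cnj z1 + w * cnj w) = p + m"
        by (metis complex_norm_square p_def m_def norm_of_real of_real_add abs_of_nonneg add_nonneg_nonneg nonneg(1,3))
      then have "(p + m)\<^sup>2 \<le> p + m"
        using test[of "cnj z1" "cnj w"] by (simp add: p_def m_def) (smt (verit) zero_le_power2)
      then show ?thesis using True nonneg by (simp add: power2_eq_square algebra_simps) (smt (verit) mult_nonneg_nonneg)
    next
      case False
      \<comment> \<open>The test vector is \<open>1 - p\<close> times \<open>(v1, 1)\<close>, where \<open>v1\<close> maximises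
        \<open>|z1 v1 + w|\<^sup>2 - |v1|\<^sup>2\<close>; the resulting inequality is the asserted one
        multiplied by \<open>1 - p\<close>.\<close>
      have a: "z1 * (cnj z1 * w) + w * complex_of_real (1 - p) = w"
        using complex_norm_square[of z1] by (simp add: p_def algebra_simps)
      have "m + q * (1 - p)\<^sup>2 \<le> p * m + (1 - p)\<^sup>2"
        using test[of "cnj z1 * w" "complex_of_real (1 - p)"] unfolding a
        by (simp add: norm_mult power_mult_distrib p_def q_def m_def del: of_real_diff)
      then have "(1 - p) * m \<le> (1 - p) * ((1 - p) * (1 - q))"
        by (simp add: power2_eq_square algebra_simps)
      then show ?thesis using False \<open>p \<le> 1\<close> by simp
    qed
  next
    fix v :: "complex^2"
    assume L: "p \<le> 1 \<and> q \<le> 1 \<and> m \<le> (1 - p) * (1 - q)"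
    define s t where "s = cmod (v $ 1)" and "t = cmod (v $ 2)"
    have "cmod (z1 * v $ 1 + w * v $ 2) \<le> cmod z1 * s + cmod w * t"
      by (metis norm_mult norm_triangle_ineq s_def t_def)
    also have "\<dots> \<le> cmod z1 * s + sqrt (1 - p) * (sqrt (1 - q) * t)"
      using L w_conv by (simp add: t_def real_sqrt_mult mult_right_mono flip: mult.assoc)
    finally have "(cmod (z1 * v $ 1 + w * v $ 2))\<^sup>2 \<le> (cmod z1 * s + sqrt (1 - p) * (sqrt (1 - q) * t))\<^sup>2"
      by (intro power_mono) auto
    also have "\<dots> \<le> ((cmod z1)\<^sup>2 + (sqrt (1 - p))\<^sup>2) * (s\<^sup>2 + (sqrt (1 - q) * t)\<^sup>2)"
    proof -
      have "(a * c + b * d)\<^sup>2 \<le> (a\<^sup>2 + b\<^sup>2) * (c\<^sup>2 + d\<^sup>2)" for a b c d :: real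
        using zero_le_power2[of "a * d - b * c"] by (simp add: power2_eq_square algebra_simps)
      then show ?thesis .
    qed
    also have "\<dots> = s\<^sup>2 + (1 - q) * t\<^sup>2"
      using L by (simp add: power_mult_distrib p_def)
    finally show "norm (X *v v) \<le> norm v"
      unfolding contr by (simp add: norm_mult power_mult_distrib q_def s_def t_def algebra_simps)
  qed
  then show ?thesis
    unfolding onorm_le_one_iff
    by (fold z1_def z2_def w_def, fold p_def q_def) (simp add: sq_conv w_conv)
qed

section \<open>Attainment of the infimum\<close>

text \<open>The operator norm is a convex function on a finite-dimensional space.\<close>

lemma continuous_on_matrix_onorm:
  "continuous_on UNIV (\<lambda>X :: complex^'n^'m. onorm ((*v) X))"
proof (intro convex_on_continuous convex_onI)
  fix t :: real and X Y :: "complex^'n^'m"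
  assume t: "0 < t" "t < 1"
  have "(*v) ((1 - t) *\<^sub>R X + t *\<^sub>R Y) = (\<lambda>v. (1 - t) *\<^sub>R (X *v v) + t *\<^sub>R (Y *v v))"
    by (rule ext) (simp add: matrix_vector_mult_def vec_eq_iff algebra_simps
        scaleR_sum_right sum.distrib sum_subtractf)
  moreover have "onorm (\<lambda>v. (1 - t) *\<^sub>R (X *v v) + t *\<^sub>R (Y *v v)) \<le>
      onorm (\<lambda>v. (1 - t) *\<^sub>R (X *v v)) + onorm (\<lambda>v. t *\<^sub>R (Y *v v))"
    by (intro onorm_triangle bounded_linear_intros matrix_vector_mul_bounded_linear)
  ultimately show "onorm ((*v) ((1 - t) *\<^sub>R X + t *\<^sub>R Y)) \<le> (1 - t) * onorm ((*v) X) + t * onorm ((*v) Y)"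
    using t by (simp add: onorm_scaleR)
qed auto

lemma matrix_norm_le_onorm:
  fixes X :: "complex^'n^'m"
  shows "norm X \<le> real CARD('m) * real CARD('n) * onorm ((*v) X)"
proof -
  have entry: "cmod (X $ i $ j) \<le> onorm ((*v) X)" for i j
  proof -
    have "X $ i $ j = (X *v axis j 1) $ i"
      by (simp add: matrix_vector_mult_def axis_def if_distrib cong: if_cong)
    also have "cmod \<dots> \<le> norm (X *v axis j 1)" by (rule Finite_Cartesian_Product.norm_nth_le)
    also have "\<dots> \<le> onorm ((*v) X)"
      using onorm[OF matrix_vector_mul_bounded_linear, of X "axis j 1"] by simp
    finally show ?thesis .
  qed
  have "norm X \<le> (\<Sum>i\<in>UNIV. norm (X $ i))"
    unfolding norm_vec_def[of X] by (intro L2_set_le_sum) auto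
  also have "\<dots> \<le> (\<Sum>i\<in>UNIV. \<Sum>j\<in>UNIV. cmod (X $ i $ j))"
    unfolding norm_vec_def[of "X $ i" for i] by (intro sum_mono L2_set_le_sum) auto
  also have "\<dots> \<le> (\<Sum>i\<in>(UNIV :: 'm set). \<Sum>j\<in>(UNIV :: 'n set). onorm ((*v) X))"
    by (intro sum_mono entry)
  also have "\<dots> = real CARD('m) * real CARD('n) * onorm ((*v) X)" by simp
  finally show ?thesis .
qed

text \<open>
  By \<open>matrix_norm_le_onorm\<close> the sublevel sets of the operator norm are bounded, so it
  suffices to minimise over a compact part of \<open>S\<close>.
\<close>

lemma Inf_onorm_attained:
  fixes S :: "(complex^'n^'m) set"
  assumes "closed S" "S \<noteq> {}"
  obtains X where "X \<in> S" "Inf {onorm ((*v) X) | X. X \<in> S} = onorm ((*v) X)"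
proof -
  obtain Y where "Y \<in> S" using assms by blast
  define K where "K = S \<inter> {X. onorm ((*v) X) \<le> onorm ((*v) Y)}"
  have "closed K"
    unfolding K_def by (intro closed_Int assms closed_Collect_le continuous_on_matrix_onorm) auto
  moreover have "bounded K"
  proof (rule boundedI)
    show "norm X \<le> real CARD('m) * real CARD('n) * onorm ((*v) Y)" if "X \<in> K" for X
      using that by (intro order_trans[OF matrix_norm_le_onorm mult_left_mono]) (auto simp: K_def)
  qed
  ultimately have "compact K" by (simp add: compact_eq_bounded_closed)
  moreover have "K \<noteq> {}" using \<open>Y \<in> S\<close> by (auto simp: K_def)
  ultimately obtain X where X: "X \<in> K" "\<And>Z. Z \<in> K \<Longrightarrow> onorm ((*v) X) \<le> onorm ((*v) Z)"
    using continuous_attains_inf continuous_on_subset[OF continuous_on_matrix_onorm] by (metis subset_UNIV)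
  have "onorm ((*v) X) \<le> onorm ((*v) Z)" if "Z \<in> S" for Z
    using X that unfolding K_def by fastforce
  then have "Inf {onorm ((*v) X) | X. X \<in> S} = onorm ((*v) X)"
    using X(1) by (intro cInf_eq_minimum) (auto simp: K_def)
  with X(1) show thesis using that by (auto simp: K_def)
qed

text \<open>
  A minimiser of the operator norm is nonzero, because \<open>I\<close> is nonsingular.  Hence the
  infimum is a positive number, and attainment turns \<open>1 < Inf\<close> into the statement that
  every admissible norm is strictly larger than one.
\<close>

lemma mu_hexa_less_one_iff:
  "mu_hexa A < 1 \<longleftrightarrow>
    (\<forall>X\<in>upper_triangular. onorm ((*v) X) \<le> 1 \<longrightarrow> det (mat 1 - A ** X) \<noteq> 0)"
proof -
  define S where "S = {X \<in> upper_triangular. det (mat 1 - A ** X) = 0}"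
  show ?thesis
  proof (cases "S = {}")
    case True
    then show ?thesis by (auto simp: mu_hexa_def S_def)
  next
    case False
    have S_eq: "S = {X. X $ 2 $ 1 = 0 \<and>
        1 - A $ 1 $ 1 * X $ 1 $ 1 - A $ 2 $ 2 * X $ 2 $ 2 + det A * X $ 1 $ 1 * X $ 2 $ 2
          - A $ 2 $ 1 * X $ 1 $ 2 = 0}"
      using det_one_minus_upper_triangular[of _ A] by (auto simp: S_def upper_triangular_def)
    have "closed S"
      unfolding S_eq by (intro closed_Collect_conj closed_Collect_eq continuous_intros)
    then obtain X where X: "X \<in> S" and I: "Inf {onorm ((*v) X) | X. X \<in> S} = onorm ((*v) X)"
      using Inf_onorm_attained False by blast
    have lower: "onorm ((*v) X) \<le> onorm ((*v) Z)" if "Z \<in> S" for Z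
      unfolding I[symmetric] using that
      by (intro cInf_lower bdd_belowI[of _ 0]) (auto intro: onorm_pos_le)
    have "X \<noteq> 0" using X by (auto simp: S_def)
    then have "0 < norm X" by simp
    also note matrix_norm_le_onorm[of X]
    finally have pos: "0 < onorm ((*v) X)" by simp
    have "mu_hexa A = 1 / onorm ((*v) X)"
      using False I by (auto simp: mu_hexa_def S_def)
    with pos have "mu_hexa A < 1 \<longleftrightarrow> 1 < onorm ((*v) X)"
      by (simp add: divide_less_eq)
    also have "\<dots> \<longleftrightarrow> (\<forall>Z\<in>S. 1 < onorm ((*v) Z))"
      using lower X by (blast intro: less_le_trans)
    finally show ?thesis by (auto simp: S_def simp flip: not_le)
  qed
qed

lemma mu_hexa_less_one_iff_no_zero:
  "mu_hexa A < 1 \<longleftrightarrow>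
    (\<forall>z1\<in>cball 0 1. \<forall>z2\<in>cball 0 1. \<forall>w\<in>cball 0 1.
       cmod w \<le> sqrt ((1 - (cmod z1)\<^sup>2) * (1 - (cmod z2)\<^sup>2)) \<longrightarrow>
       1 - A $ 1 $ 1 * z1 - A $ 2 $ 2 * z2 + det A * z1 * z2 \<noteq> A $ 2 $ 1 * w)"
  (is "_ \<longleftrightarrow> ?R")
proof
  assume mu: "mu_hexa A < 1"
  show ?R
  proof (intro ballI impI)
    fix z1 z2 w
    assume z: "z1 \<in> cball 0 1" "z2 \<in> cball 0 1"
      and w: "cmod w \<le> sqrt ((1 - (cmod z1)\<^sup>2) * (1 - (cmod z2)\<^sup>2))"
    define X :: "complex^2^2" where "X = vector [vector [z1, w], vector [0, z2]]"
    have entries: "X $ 1 $ 1 = z1" "X $ 1 $ 2 = w" "X $ 2 $ 2 = z2"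
      and X: "X \<in> upper_triangular"
      by (simp_all add: X_def upper_triangular_def)
    have "onorm ((*v) X) \<le> 1"
      using z w by (simp add: upper_triangular_contraction_iff[OF X] entries)
    with mu X have "det (mat 1 - A ** X) \<noteq> 0"
      by (simp add: mu_hexa_less_one_iff)
    then show "1 - A $ 1 $ 1 * z1 - A $ 2 $ 2 * z2 + det A * z1 * z2 \<noteq> A $ 2 $ 1 * w"
      by (simp add: det_one_minus_upper_triangular[OF X] entries)
  qed
next
  assume R: ?R
  show "mu_hexa A < 1"
    unfolding mu_hexa_less_one_iff
  proof (intro ballI impI)
    fix X :: "complex^2^2"
    assume X: "X \<in> upper_triangular" and "onorm ((*v) X) \<le> 1"
    then have z: "cmod (X $ 1 $ 1) \<le> 1" "cmod (X $ 2 $ 2) \<le> 1"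
      and w: "cmod (X $ 1 $ 2) \<le> sqrt ((1 - (cmod (X $ 1 $ 1))\<^sup>2) * (1 - (cmod (X $ 2 $ 2))\<^sup>2))"
      by (simp_all add: upper_triangular_contraction_iff)
    have "sqrt ((1 - (cmod (X $ 1 $ 1))\<^sup>2) * (1 - (cmod (X $ 2 $ 2))\<^sup>2)) \<le> 1"
      using z by (simp add: mult_le_one abs_square_le_1)
    with w have "cmod (X $ 1 $ 2) \<le> 1" by linarith
    with R z w show "det (mat 1 - A ** X) \<noteq> 0"
      by (simp add: det_one_minus_upper_triangular[OF X])
  qed
qed

section \<open>The functions \<open>\<psi>\<close> and the constant \<open>K_*\<close>\<close>

lemma cmod_psi_factor:
  "cmod (psi z1 z2 (a, x1, x2, x3)) = cmod a * cmod (psi z1 z2 (1, x1, x2, x3))"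
  by (simp add: norm_mult norm_divide)

text \<open>
  The image of the closed disc of radius \<open>s\<close> under \<open>w \<mapsto> a w\<close> is the closed disc of
  radius \<open>|a| s\<close>; it omits \<open>D\<close> exactly when \<open>|a| s < |D|\<close>.
\<close>

lemma psi_less_one_iff:
  assumes x: "(x1, x2, x3) \<in> tetrablock" and z: "z1 \<in> cball 0 1" "z2 \<in> cball 0 1"
  shows "cmod (psi z1 z2 (a, x1, x2, x3)) < 1 \<longleftrightarrow>
    (\<forall>w. cmod w \<le> sqrt ((1 - (cmod z1)\<^sup>2) * (1 - (cmod z2)\<^sup>2)) \<longrightarrow>
       1 - x1 * z1 - x2 * z2 + x3 * z1 * z2 \<noteq> a * w)"
proof -
  define s D where "s = sqrt ((1 - (cmod z1)\<^sup>2) * (1 - (cmod z2)\<^sup>2))"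
    and "D = 1 - x1 * z1 - x2 * z2 + x3 * z1 * z2"
  have "D \<noteq> 0" using x z by (auto simp: tetrablock_def D_def)
  have "0 \<le> s" using z by (simp add: s_def abs_square_le_1)
  then have "cmod (psi z1 z2 (a, x1, x2, x3)) = cmod a * s / cmod D"
    by (simp add: norm_mult norm_divide s_def D_def)
  then have "cmod (psi z1 z2 (a, x1, x2, x3)) < 1 \<longleftrightarrow> cmod a * s < cmod D"
    using \<open>D \<noteq> 0\<close> by simp
  also have "\<dots> \<longleftrightarrow> (\<forall>w. cmod w \<le> s \<longrightarrow> D \<noteq> a * w)"
  proof (intro iffI allI impI notI)
    fix w assume "cmod a * s < cmod D" "cmod w \<le> s" "D = a * w"
    then show False
      by (metis leD mult_left_mono norm_ge_zero norm_mult)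
  next
    assume R: "\<forall>w. cmod w \<le> s \<longrightarrow> D \<noteq> a * w"
    show "cmod a * s < cmod D"
    proof (rule ccontr)
      assume le: "\<not> cmod a * s < cmod D"
      then have "a \<noteq> 0" using \<open>D \<noteq> 0\<close> by auto
      with le have "cmod (D / a) \<le> s" by (simp add: norm_divide field_simps)
      with R have "D \<noteq> a * (D / a)" by blast
      with \<open>a \<noteq> 0\<close> show False by simp
    qed
  qed
  finally show ?thesis by (simp only: s_def D_def)
qed

lemma mu_hexa_less_one_iff_psi:
  "mu_hexa A < 1 \<longleftrightarrow>
    (A $ 1 $ 1, A $ 2 $ 2, det A) \<in> tetrablock \<and>
    (\<forall>z1\<in>cball 0 1. \<forall>z2\<in>cball 0 1.
       cmod (psi z1 z2 (A $ 2 $ 1, A $ 1 $ 1, A $ 2 $ 2, det A)) < 1)"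
proof -
  have radius: "sqrt ((1 - (cmod z1)\<^sup>2) * (1 - (cmod z2)\<^sup>2)) \<le> 1"
    "0 \<le> sqrt ((1 - (cmod z1)\<^sup>2) * (1 - (cmod z2)\<^sup>2))"
    if "z1 \<in> cball 0 1" "z2 \<in> cball 0 1" for z1 z2 :: complex
    using that by (simp_all add: mult_le_one abs_square_le_1)
  have tetra: "(A $ 1 $ 1, A $ 2 $ 2, det A) \<in> tetrablock" if "mu_hexa A < 1"
    unfolding tetrablock_def
  proof (clarify)
    fix z1 z2 :: complex
    assume z: "z1 \<in> cball 0 1" "z2 \<in> cball 0 1"
      and "1 - A $ 1 $ 1 * z1 - A $ 2 $ 2 * z2 + det A * z1 * z2 = 0"
    moreover have "(0::complex) \<in> cball 0 1" "cmod 0 \<le> sqrt ((1 - (cmod z1)\<^sup>2) * (1 - (cmod z2)\<^sup>2))"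
      using radius(2)[OF z] by simp_all
    ultimately show False
      using that unfolding mu_hexa_less_one_iff_no_zero by (metis mult_zero_right)
  qed
  have "mu_hexa A < 1 \<longleftrightarrow>
    (\<forall>z1\<in>cball 0 1. \<forall>z2\<in>cball 0 1.
       cmod (psi z1 z2 (A $ 2 $ 1, A $ 1 $ 1, A $ 2 $ 2, det A)) < 1)"
    if T: "(A $ 1 $ 1, A $ 2 $ 2, det A) \<in> tetrablock"
    unfolding mu_hexa_less_one_iff_no_zero
  proof (intro ball_cong refl)
    fix z1 z2 :: complex
    assume z: "z1 \<in> cball 0 1" "z2 \<in> cball 0 1"
    show "(\<forall>w\<in>cball 0 1. cmod w \<le> sqrt ((1 - (cmod z1)\<^sup>2) * (1 - (cmod z2)\<^sup>2)) \<longrightarrow>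
        1 - A $ 1 $ 1 * z1 - A $ 2 $ 2 * z2 + det A * z1 * z2 \<noteq> A $ 2 $ 1 * w) \<longleftrightarrow>
      cmod (psi z1 z2 (A $ 2 $ 1, A $ 1 $ 1, A $ 2 $ 2, det A)) < 1"
      unfolding psi_less_one_iff[OF T z] using order_trans[OF _ radius(1)[OF z]]
      by (auto simp only: mem_cball_0)
  qed
  with tetra show ?thesis by blast
qed

text \<open>The strict bound survives passing to the supremum because the supremum is attained.\<close>

lemma K_star_less_one_iff:
  assumes "(x1, x2, x3) \<in> tetrablock"
  shows "cmod a * K_star (x1, x2, x3) < 1 \<longleftrightarrow>
    (\<forall>z1\<in>cball 0 1. \<forall>z2\<in>cball 0 1. cmod (psi z1 z2 (a, x1, x2, x3)) < 1)"
proof -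
  define f where "f z1 z2 = cmod (psi z1 z2 (1, x1, x2, x3))" for z1 z2
  obtain u1 u2 where u: "u1 \<in> cball 0 1" "u2 \<in> cball 0 1" "K_star (x1, x2, x3) = f u1 u2"
    and max: "\<forall>z1\<in>cball 0 1. \<forall>z2\<in>cball 0 1. f z1 z2 \<le> K_star (x1, x2, x3)"
    using K_star_attained[OF assms] unfolding f_def by blast
  have "cmod a * K_star (x1, x2, x3) < 1 \<longleftrightarrow>
      (\<forall>z1\<in>cball 0 1. \<forall>z2\<in>cball 0 1. cmod a * f z1 z2 < 1)"
  proof (intro iffI ballI)
    fix z1 z2 :: complex
    assume "cmod a * K_star (x1, x2, x3) < 1" "z1 \<in> cball 0 1" "z2 \<in> cball 0 1"
    moreover from this have "cmod a * f z1 z2 \<le> cmod a * K_star (x1, x2, x3)"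
      using max by (intro mult_left_mono) auto
    ultimately show "cmod a * f z1 z2 < 1" by linarith
  next
    assume "\<forall>z1\<in>cball 0 1. \<forall>z2\<in>cball 0 1. cmod a * f z1 z2 < 1"
    then show "cmod a * K_star (x1, x2, x3) < 1"
      unfolding u(3) using u(1,2) by blast
  qed
  then show ?thesis
    by (simp only: f_def cmod_psi_factor[of _ _ a])
qed

lemma psi_zero_on_boundary:
  assumes "z1 \<in> cball 0 1" "z2 \<in> cball 0 1" "z1 \<notin> ball 0 1 \<or> z2 \<notin> ball 0 1"
  shows "psi z1 z2 y = 0"
proof -
  obtain a x1 x2 x3 where "y = (a, x1, x2, x3)" by (cases y)
  moreover have "cmod z1 = 1 \<or> cmod z2 = 1" using assms by auto
  ultimately show ?thesis by auto
qed

lemma psi_open_iff_closed: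
  "(\<forall>z1\<in>ball 0 1. \<forall>z2\<in>ball 0 1. cmod (psi z1 z2 y) < 1) \<longleftrightarrow>
   (\<forall>z1\<in>cball 0 1. \<forall>z2\<in>cball 0 1. cmod (psi z1 z2 y) < 1)"
proof (intro iffI ballI)
  fix z1 z2 :: complex
  assume R: "\<forall>z1\<in>ball 0 1. \<forall>z2\<in>ball 0 1. cmod (psi z1 z2 y) < 1"
    and z: "z1 \<in> cball 0 1" "z2 \<in> cball 0 1"
  show "cmod (psi z1 z2 y) < 1"
  proof (cases "z1 \<in> ball 0 1 \<and> z2 \<in> ball 0 1")
    case False
    with psi_zero_on_boundary[OF z] show ?thesis by simp
  qed (use R in blast)
qed auto

text \<open>
  The open bidisc is not compact, so strictness of the bound on the supremum comes from
  the comparison with \<open>|a| K_*\<close>, a maximum over the closed bidisc.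
\<close>

lemma SUP_psi_less_one_iff:
  assumes "(x1, x2, x3) \<in> tetrablock"
  shows "(SUP (z1, z2) \<in> ball 0 1 \<times> ball 0 1. cmod (psi z1 z2 (a, x1, x2, x3))) < 1 \<longleftrightarrow>
    (\<forall>z1\<in>ball 0 1. \<forall>z2\<in>ball 0 1. cmod (psi z1 z2 (a, x1, x2, x3)) < 1)"
  (is "?sup < 1 \<longleftrightarrow> ?R")
proof
  assume "?sup < 1"
  moreover have "cmod (psi z1 z2 (a, x1, x2, x3)) \<le> ?sup" if "z1 \<in> ball 0 1" "z2 \<in> ball 0 1" for z1 z2
    using that by (intro cSUP_upper2[OF bdd_above_psi[OF assms], of "(z1, z2)"]) auto
  ultimately show ?R by (meson le_less_trans)
next
  assume ?R
  then have "cmod a * K_star (x1, x2, x3) < 1"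
    by (simp only: psi_open_iff_closed K_star_less_one_iff[OF assms])
  moreover have "?sup \<le> cmod a * K_star (x1, x2, x3)"
  proof (rule cSUP_least)
    show "(case z of (z1, z2) \<Rightarrow> cmod (psi z1 z2 (a, x1, x2, x3))) \<le> cmod a * K_star (x1, x2, x3)"
      if "z \<in> ball 0 1 \<times> ball 0 1" for z :: "complex \<times> complex"
    proof -
      obtain z1 z2 where z: "z = (z1, z2)" by (cases z)
      with that have "z1 \<in> cball 0 1" "z2 \<in> cball 0 1" by auto
      then have "cmod (psi z1 z2 (1, x1, x2, x3)) \<le> K_star (x1, x2, x3)"
        using K_star_attained[OF assms] by blast
      then show ?thesis
        by (simp only: z prod.case cmod_psi_factor[of _ _ a] mult_left_mono norm_ge_zero)
    qed
  qed auto
  ultimately show "?sup < 1" by linarith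
qed

section \<open>Characterisations of the \<open>\<mu>\<close>-hexablock\<close>

theorem theorem3p4:
  shows "(\<forall>A :: complex^2^2.
      (mu_hexa A < 1 \<longleftrightarrow>
        (\<forall>z1\<in>cball 0 1. \<forall>z2\<in>cball 0 1. \<forall>w\<in>cball 0 1.
           cmod w \<le> sqrt ((1 - (cmod z1)\<^sup>2) * (1 - (cmod z2)\<^sup>2)) \<longrightarrow>
           1 - A $ 1 $ 1 * z1 - A $ 2 $ 2 * z2 + det A * z1 * z2 \<noteq> A $ 2 $ 1 * w)) \<and>
      (mu_hexa A < 1 \<longleftrightarrow>
        (A $ 1 $ 1, A $ 2 $ 2, det A) \<in> tetrablock \<and>
        (SUP (z1, z2) \<in> ball 0 1 \<times> ball 0 1.
           cmod (psi z1 z2 (A $ 2 $ 1, A $ 1 $ 1, A $ 2 $ 2, det A))) < 1) \<and>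
      (mu_hexa A < 1 \<longleftrightarrow>
        (A $ 1 $ 1, A $ 2 $ 2, det A) \<in> tetrablock \<and>
        (\<forall>z1\<in>ball 0 1. \<forall>z2\<in>ball 0 1.
           cmod (psi z1 z2 (A $ 2 $ 1, A $ 1 $ 1, A $ 2 $ 2, det A)) < 1)) \<and>
      (mu_hexa A < 1 \<longleftrightarrow>
        (A $ 1 $ 1, A $ 2 $ 2, det A) \<in> tetrablock \<and>
        cmod (A $ 2 $ 1) * K_star (A $ 1 $ 1, A $ 2 $ 2, det A) < 1)) \<and>
    mu_hexablock =
      {(A $ 2 $ 1, A $ 1 $ 1, A $ 2 $ 2, det A) | A :: complex^2^2.
         (A $ 2 $ 1, A $ 1 $ 1, A $ 2 $ 2, det A) \<in> UNIV \<times> tetrablock \<and>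
         cmod (A $ 2 $ 1) * K_star (A $ 1 $ 1, A $ 2 $ 2, det A) < 1}"
proof -
  have K: "mu_hexa A < 1 \<longleftrightarrow>
      (A $ 1 $ 1, A $ 2 $ 2, det A) \<in> tetrablock \<and>
      cmod (A $ 2 $ 1) * K_star (A $ 1 $ 1, A $ 2 $ 2, det A) < 1" for A
    using mu_hexa_less_one_iff_psi[of A] K_star_less_one_iff by blast
  have opn: "mu_hexa A < 1 \<longleftrightarrow>
      (A $ 1 $ 1, A $ 2 $ 2, det A) \<in> tetrablock \<and>
      (\<forall>z1\<in>ball 0 1. \<forall>z2\<in>ball 0 1.
         cmod (psi z1 z2 (A $ 2 $ 1, A $ 1 $ 1, A $ 2 $ 2, det A)) < 1)" for A
    unfolding psi_open_iff_closed by (rule mu_hexa_less_one_iff_psi)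
  have sup: "mu_hexa A < 1 \<longleftrightarrow>
      (A $ 1 $ 1, A $ 2 $ 2, det A) \<in> tetrablock \<and>
      (SUP (z1, z2) \<in> ball 0 1 \<times> ball 0 1.
         cmod (psi z1 z2 (A $ 2 $ 1, A $ 1 $ 1, A $ 2 $ 2, det A))) < 1" for A
    using opn[of A] SUP_psi_less_one_iff by blast
  have "mu_hexablock =
      {(A $ 2 $ 1, A $ 1 $ 1, A $ 2 $ 2, det A) | A :: complex^2^2.
         (A $ 2 $ 1, A $ 1 $ 1, A $ 2 $ 2, det A) \<in> UNIV \<times> tetrablock \<and>
         cmod (A $ 2 $ 1) * K_star (A $ 1 $ 1, A $ 2 $ 2, det A) < 1}"
    unfolding mu_hexablock_def hexa_proj_def K by (simp only: mem_Times_iff UNIV_I fst_conv snd_conv simp_thms)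
  then show ?thesis
    by (intro conjI allI mu_hexa_less_one_iff_no_zero sup opn K)
qed

end
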